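(* Let $\{\mathbf{x}^{k}\}$ be a sequence generated by the algorithm FBi-PG (defined in the context, with $t_k=(k+a)/a$ for $k\ge 0$ and an integer $a\ge 2$) with $\gamma>2$. Then for all integers $k\ge 1$ and all $\mathbf{x}'\in X'$, $$\varphi(\mathbf{x}^{k})-\varphi(\mathbf{x}')\le \frac{a^{2}}{2(k+1)^{2}}\left(\beta\|\mathbf{x}^{0}-\mathbf{x}'\|^{2}+\frac{2}{\gamma-2}\bigl(\omega(\mathbf{x}')-\omega^{\ast}\bigr)\right).$$
   Context: Bi-level problem: the inner problem is $\min_{\mathbf{x}\in\mathbb{R}^n}\{\varphi(\mathbf{x}):=f(\mathbf{x})+g(\mathbf{x})\}$ with solution set $X^{\ast}$; the outer problem is $\min_{\mathbf{x}\in X^{\ast}}\{\omega(\mathbf{x}):=\sigma(\mathbf{x})+\psi(\mathbf{x})\}$, and $X'\subset X^{\ast}$ is the set of its optimal solutions (minimizers of $\omega$ over $X^\ast$, at which $\omega$ is finite). Standing assumptions: (i) $f,\sigma:\mathbb{R}^n\to\mathbb{R}$ are convex and continuously differentiable with Lipschitz continuous gradients with constants $\beta_f,\beta_\sigma$, and $\beta:=\beta_f+\beta_\sigma>0$; (ii) $g,\psi:\mathbb{R}^n\to(-\infty,\infty]$ are proper, lower semicontinuous and convex; (iii) $X^{\ast}\ne\emptyset$; (iv) $\omega^{\ast}:=\inf_{\mathbf{x}\in\mathbb{R}^n}\omega(\mathbf{x})>-\infty$. Norms are Euclidean. Algorithm FBi-PG: input $\gamma>0$ and an integer $a\ge 2$.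 Set $\alpha_{-1}=t_{-1}=0$, $\mathbf{x}^{0}=\mathbf{x}^{-1}\in\mathbb{R}^n$ arbitrary, and for $k\ge0$ let $\alpha_k=(k+a)^{-\gamma}$, $t_k=(k+a)/a$, $f_k=f+\alpha_k\sigma$, $g_k=g+\alpha_k\psi$. For $k=0,1,2,\ldots$: $$\mathbf{y}^{k}=\mathbf{x}^{k}+t_k^{-1}(t_{k-1}-1)(\mathbf{x}^{k}-\mathbf{x}^{k-1}),\qquad \mathbf{x}^{k+1}=\operatorname*{arg\,min}_{\mathbf{x}\in\mathbb{R}^n}\Bigl\{g_k(\mathbf{x})+\mathbf{x}^{T}\nabla f_k(\mathbf{y}^{k})+\tfrac{\beta}{2}\|\mathbf{x}-\mathbf{y}^{k}\|^{2}\Bigr\}.$$ *)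

theory Defs
  imports "HOL-Analysis.Analysis"
begin

text \<open>
  Functions with values in \<open>(-\<infinity>, \<infinity>]\<close> are modelled as \<^typ>\<open>ereal\<close>-valued functions that
  avoid \<open>-\<infinity>\<close>; the latter is part of properness.
\<close>

definition proper_fun :: "('a \<Rightarrow> ereal) \<Rightarrow> bool" where
  "proper_fun h \<longleftrightarrow> (\<forall>x. h x \<noteq> -\<infinity>) \<and> (\<exists>x. h x \<noteq> \<infinity>)"

definition lower_semicontinuous :: "('a::topological_space \<Rightarrow> ereal) \<Rightarrow> bool" where
  "lower_semicontinuous h \<longleftrightarrow> (\<forall>x. h x \<le> Liminf (at x) h)"

text \<open>
  At \<open>u = 0\<close> and \<open>u = 1\<close> the inequality is trivial because \<open>0 * \<infinity> = 0\<close> in \<^typ>\<open>ereal\<close>.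
\<close>

definition convex_fun :: "('a::real_vector \<Rightarrow> ereal) \<Rightarrow> bool" where
  "convex_fun h \<longleftrightarrow> (\<forall>x y. \<forall>u::real. 0 \<le> u \<and> u \<le> 1 \<longrightarrow>
     h ((1 - u) *\<^sub>R x + u *\<^sub>R y) \<le> ereal (1 - u) * h x + ereal u * h y)"

definition grad :: "('a::real_inner \<Rightarrow> real) \<Rightarrow> 'a \<Rightarrow> 'a" where
  "grad h x = (THE D. GDERIV h x :> D)"

lemma grad_eqI:
  assumes "GDERIV h x :> D"
  shows "grad h x = D"
  unfolding grad_def
proof (rule the_equality)
  fix D' assume "GDERIV h x :> D'"
  then have "(\<lambda>v. inner v D') = (\<lambda>v. inner v D)"
    using assms has_derivative_unique unfolding gderiv_def by blast
  then have "inner v D' = inner v D" for v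
    by meson
  then show "D' = D"
    by (metis vector_eq_ldot)
qed (fact assms)

lemma GDERIV_grad:
  fixes h :: "'a::euclidean_space \<Rightarrow> real"
  assumes "h differentiable at x"
  shows "GDERIV h x :> grad h x"
proof -
  obtain h' where h': "(h has_derivative h') (at x)"
    using assms unfolding differentiable_def by blast
  then have "linear h'"
    by (rule has_derivative_linear)
  then have "h' = (\<lambda>v. inner v (adjoint h' 1))"
    using adjoint_works[of h' _ 1] by (auto simp: fun_eq_iff)
  then have "GDERIV h x :> adjoint h' 1"
    using h' unfolding gderiv_def by simp
  then show ?thesis
    using grad_eqI by metis
qed

definition smooth_convex :: "real \<Rightarrow> ('a::real_inner \<Rightarrow> real) \<Rightarrow> bool" where
  "smooth_convex L h \<longleftrightarrow> convex_on UNIV h \<and> h differentiable_on UNIV \<and>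
     continuous_on UNIV (grad h) \<and> L-lipschitz_on UNIV (grad h)"

definition objective :: "('a \<Rightarrow> real) \<Rightarrow> ('a \<Rightarrow> ereal) \<Rightarrow> 'a \<Rightarrow> ereal" where
  "objective h p x = ereal (h x) + p x"

definition inner_solutions :: "('a \<Rightarrow> ereal) \<Rightarrow> 'a set" where
  "inner_solutions \<phi> = {x. is_arg_min \<phi> (\<lambda>_. True) x}"

definition outer_solutions :: "('a \<Rightarrow> ereal) \<Rightarrow> ('a \<Rightarrow> ereal) \<Rightarrow> 'a set" where
  "outer_solutions \<phi> \<omega> =
     {x. is_arg_min \<omega> (\<lambda>y. y \<in> inner_solutions \<phi>) x \<and> \<bar>\<omega> x\<bar> \<noteq> \<infinity>}"

text \<open>
  All sequences of the algorithm are indexed by \<^typ>\<open>int\<close> so that the index \<open>-1\<close> is available;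
  values at indices below \<open>-1\<close> play no role.
\<close>

definition reg_param :: "real \<Rightarrow> int \<Rightarrow> int \<Rightarrow> real" where
  "reg_param \<gamma> a k = (if k < 0 then 0 else real_of_int (k + a) powr (- \<gamma>))"

definition step_param :: "int \<Rightarrow> int \<Rightarrow> real" where
  "step_param a k = (if k < 0 then 0 else real_of_int (k + a) / real_of_int a)"

definition reg_smooth ::
  "('a \<Rightarrow> real) \<Rightarrow> ('a \<Rightarrow> real) \<Rightarrow> real \<Rightarrow> int \<Rightarrow> int \<Rightarrow> 'a \<Rightarrow> real" where
  "reg_smooth f \<sigma> \<gamma> a k x = f x + reg_param \<gamma> a k * \<sigma> x"

definition reg_nonsmooth ::
  "('a \<Rightarrow> ereal) \<Rightarrow> ('a \<Rightarrow> ereal) \<Rightarrow> real \<Rightarrow> int \<Rightarrow> int \<Rightarrow> 'a \<Rightarrow> ereal" where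
  "reg_nonsmooth g \<psi> \<gamma> a k x = g x + ereal (reg_param \<gamma> a k) * \<psi> x"

definition extrapolation :: "int \<Rightarrow> (int \<Rightarrow> 'a::real_vector) \<Rightarrow> int \<Rightarrow> 'a" where
  "extrapolation a x k =
     x k + (inverse (step_param a k) * (step_param a (k - 1) - 1)) *\<^sub>R (x k - x (k - 1))"

definition fbi_pg ::
  "('a::real_inner \<Rightarrow> real) \<Rightarrow> ('a \<Rightarrow> ereal) \<Rightarrow> ('a \<Rightarrow> real) \<Rightarrow> ('a \<Rightarrow> ereal) \<Rightarrow>
   real \<Rightarrow> real \<Rightarrow> int \<Rightarrow> (int \<Rightarrow> 'a) \<Rightarrow> bool" where
  "fbi_pg f g \<sigma> \<psi> \<beta> \<gamma> a x \<longleftrightarrow>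
     x 0 = x (-1) \<and>
     (\<forall>k\<ge>0. is_arg_min
        (\<lambda>z. reg_nonsmooth g \<psi> \<gamma> a k z
              + ereal (z \<bullet> grad (reg_smooth f \<sigma> \<gamma> a k) (extrapolation a x k)
                       + \<beta> / 2 * (norm (z - extrapolation a x k))\<^sup>2))
        (\<lambda>_. True) (x (k + 1)))"

end

theory Submission
  imports Defs
begin

text \<open>
  Write \<open>\<phi>\<close>, \<open>\<omega>\<close> for the inner and outer objectives, and abbreviate \<open>\<alpha>\<^sub>k\<close>, \<open>t\<^sub>k\<close> as in the
  algorithm.  Step \<open>k\<close> is one accelerated proximal gradient step (FISTA) for the regularized
  function \<open>F\<^sub>k = \<phi> + \<alpha>\<^sub>k \<omega>\<close>; since \<open>\<alpha>\<^sub>k \<le> 1\<close>, the constant \<open>\<beta>\<close> is admissible for every \<open>k\<close>.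
  With \<open>u\<^sub>k = t\<^bsub>k-1\<^esub> x\<^sub>k - (t\<^bsub>k-1\<^esub> - 1) x\<^bsub>k-1\<^esub> - x'\<close> the classical FISTA estimate
  (\<open>accelerated_prox_step\<close>) reads
  \<open>t\<^sub>k\<^sup>2 (F\<^sub>k x\<^bsub>k+1\<^esub> - F\<^sub>k x') + \<beta>/2 \<bar>u\<^bsub>k+1\<^esub>\<bar>\<^sup>2
    \<le> t\<^sub>k (t\<^sub>k - 1) (F\<^sub>k x\<^sub>k - F\<^sub>k x') + \<beta>/2 \<bar>u\<^sub>k\<bar>\<^sup>2\<close>.

  This does not telescope directly, for two reasons: \<open>F\<^sub>k\<close> changes with \<open>k\<close>, and \<open>x'\<close> does not
  minimize \<open>F\<^sub>k\<close>.  Both are cured by measuring the outer objective from its infimum \<open>\<omega>\<^sup>*\<close> instead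
  of from \<open>\<omega> x'\<close>.  The quantity \<open>(\<phi> x\<^sub>j - \<phi> x') + \<alpha>\<^sub>k (\<omega> x\<^sub>j - \<omega>\<^sup>*)\<close> is a sum of two nonnegative
  terms, so it only decreases when \<open>\<alpha>\<^bsub>k-1\<^esub>\<close> is replaced by the smaller \<open>\<alpha>\<^sub>k\<close>, and the factor
  \<open>t\<^sub>k (t\<^sub>k - 1)\<close> may be enlarged to \<open>t\<^bsub>k-1\<^esub>\<^sup>2\<close>.  The price for moving the reference value is
  \<open>(t\<^sub>k\<^sup>2 - t\<^sub>k (t\<^sub>k - 1)) \<alpha>\<^sub>k (\<omega> x' - \<omega>\<^sup>*) = \<alpha>\<^sub>k t\<^sub>k (\<omega> x' - \<omega>\<^sup>*)\<close> per step (\<open>energy_step\<close>).  The sum of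
  all \<open>\<alpha>\<^sub>k t\<^sub>k = (k + a)\<^bsup>1-\<gamma>\<^esup> / a\<close> is at most \<open>1 / (\<gamma> - 2)\<close> by comparison with a telescoping
  series (\<open>sum_reg_step_le\<close>), and \<open>t\<^bsub>k-1\<^esub> \<ge> (k + 1) / a\<close> turns the resulting bound on
  \<open>t\<^bsub>k-1\<^esub>\<^sup>2 (\<phi> x\<^sub>k - \<phi> x')\<close> into the claimed rate (\<open>inner_gap_le\<close>).

  The starting point may have \<open>g x\<^sub>0 = \<infinity>\<close> or \<open>\<psi> x\<^sub>0 = \<infinity>\<close>.  This is harmless: \<open>t\<^sub>0 = 1\<close>, so the
  weight \<open>t\<^sub>0 (t\<^sub>0 - 1)\<close> of \<open>F\<^sub>0 x\<^sub>0\<close> vanishes, and all later iterates have finite values because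
  they minimize a function that is finite at \<open>x'\<close>.
\<close>

section \<open>Smooth convex functions and regularized objectives\<close>

lemma smooth_convex_has_derivative:
  fixes h :: "'a::euclidean_space \<Rightarrow> real"
  assumes "smooth_convex L h"
  shows "(h has_derivative (\<lambda>v. v \<bullet> grad h x)) (at x)"
proof -
  have "h differentiable at x"
    using assms unfolding smooth_convex_def by (simp add: differentiable_on_def)
  then show ?thesis
    using GDERIV_grad unfolding gderiv_def by blast
qed

lemma smooth_convex_DERIV_along_line:
  fixes h :: "'a::euclidean_space \<Rightarrow> real"
  assumes "smooth_convex L h"
  shows "((\<lambda>s. h (y + s *\<^sub>R d)) has_real_derivative d \<bullet> grad h (y + s *\<^sub>R d)) (at s)"
proof -
  have "((\<lambda>s. y + s *\<^sub>R d) has_derivative (\<lambda>s. s *\<^sub>R d)) (at s)"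
    by (auto intro!: derivative_eq_intros)
  from diff_chain_at[OF this smooth_convex_has_derivative[OF assms]]
  show ?thesis
    unfolding has_field_derivative_def o_def by (simp add: mult_commute_abs)
qed

lemma smooth_convex_above_tangent:
  fixes h :: "'a::euclidean_space \<Rightarrow> real"
  assumes "smooth_convex L h"
  shows "h y + (z - y) \<bullet> grad h y \<le> h z"
proof -
  define q where "q = (\<lambda>s. h (y + s *\<^sub>R (z - y)))"
  have conv: "convex_on UNIV h"
    using assms unfolding smooth_convex_def by blast
  have "convex_on UNIV q"
  proof (rule convex_onI)
    fix t a b :: real assume t: "0 < t" "t < 1"
    have "y + ((1 - t) *\<^sub>R a + t *\<^sub>R b) *\<^sub>R (z - y) =
        (1 - t) *\<^sub>R (y + a *\<^sub>R (z - y)) + t *\<^sub>R (y + b *\<^sub>R (z - y))"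
      by (simp add: algebra_simps)
    then show "q ((1 - t) *\<^sub>R a + t *\<^sub>R b) \<le> (1 - t) * q a + t * q b"
      unfolding q_def using convex_onD[OF conv, of t] t by simp
  qed simp
  moreover have "(q has_real_derivative (z - y) \<bullet> grad h y) (at 0 within UNIV)"
    using smooth_convex_DERIV_along_line[OF assms, of y "z - y" 0] unfolding q_def by simp
  ultimately have "q 1 - q 0 \<ge> (z - y) \<bullet> grad h y * (1 - 0)"
    by (intro convex_on_imp_above_tangent) auto
  then show ?thesis
    by (simp add: q_def)
qed

text \<open>
  Subtracting the claimed majorant along the segment from \<open>y\<close> to \<open>z\<close> leaves a function whose
  derivative is nonpositive by the Lipschitz condition, so no integral of the gradient is needed.
\<close>

lemma smooth_convex_descent:
  fixes h :: "'a::euclidean_space \<Rightarrow> real"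
  assumes "smooth_convex L h"
  shows "h z \<le> h y + (z - y) \<bullet> grad h y + L / 2 * (norm (z - y))\<^sup>2"
proof -
  define d where "d = z - y"
  define q where "q = (\<lambda>s. h (y + s *\<^sub>R d) - s * (d \<bullet> grad h y) - L / 2 * s\<^sup>2 * (norm d)\<^sup>2)"
  have lip: "L-lipschitz_on UNIV (grad h)"
    using assms unfolding smooth_convex_def by blast
  have "q 1 \<le> q 0"
  proof (rule DERIV_nonpos_imp_nonincreasing[of 0 1 q])
    fix s :: real assume s: "0 \<le> s" "s \<le> 1"
    let ?D = "d \<bullet> (grad h (y + s *\<^sub>R d) - grad h y) - L * s * (norm d)\<^sup>2"
    have "(q has_real_derivative ?D) (at s)"
      unfolding q_def
      by (rule derivative_eq_intros smooth_convex_DERIV_along_line[OF assms] refl)+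
         (simp add: inner_diff_right algebra_simps)
    moreover have "d \<bullet> (grad h (y + s *\<^sub>R d) - grad h y) \<le> norm d * (L * (s * norm d))"
    proof -
      have "d \<bullet> (grad h (y + s *\<^sub>R d) - grad h y) \<le> norm d * norm (grad h (y + s *\<^sub>R d) - grad h y)"
        by (rule norm_cauchy_schwarz)
      also have "norm (grad h (y + s *\<^sub>R d) - grad h y) \<le> L * (s * norm d)"
        using lipschitz_onD[OF lip, of "y + s *\<^sub>R d" y] s by (simp add: dist_norm)
      finally show ?thesis by (simp add: mult_left_mono)
    qed
    ultimately show "\<exists>D. (q has_real_derivative D) (at s) \<and> D \<le> 0"
      by (intro exI[of _ ?D]) (auto simp: power2_eq_square algebra_simps)
  qed simp
  then show ?thesis
    by (simp add: q_def d_def)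
qed

lemma smooth_convex_add_scaled:
  fixes h s :: "'a::euclidean_space \<Rightarrow> real"
  assumes h: "smooth_convex L h" and s: "smooth_convex M s" and c: "0 \<le> c"
  shows "smooth_convex (L + c * M) (\<lambda>x. h x + c * s x)"
proof -
  have der: "GDERIV (\<lambda>x. h x + c * s x) x :> grad h x + c *\<^sub>R grad s x" for x
    unfolding gderiv_def
    by (rule derivative_eq_intros smooth_convex_has_derivative[OF h]
          smooth_convex_has_derivative[OF s] refl)+ (simp add: inner_add_right)
  then have grad: "grad (\<lambda>x. h x + c * s x) = (\<lambda>x. grad h x + c *\<^sub>R grad s x)"
    using grad_eqI by blast
  have "convex_on UNIV (\<lambda>x. h x + c * s x)"
    using h s c unfolding smooth_convex_def by (intro convex_on_add convex_on_cmul) auto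
  moreover have "(\<lambda>x. h x + c * s x) differentiable_on UNIV"
    using der unfolding gderiv_def differentiable_on_def differentiable_def by auto
  moreover have "continuous_on UNIV (\<lambda>x. grad h x + c *\<^sub>R grad s x)"
    using h s unfolding smooth_convex_def by (intro continuous_intros) auto
  moreover have "(L + c * M)-lipschitz_on UNIV (\<lambda>x. grad h x + c *\<^sub>R grad s x)"
    using h s c lipschitz_on_add[of L UNIV "grad h" "c * M" "\<lambda>x. c *\<^sub>R grad s x"]
      lipschitz_on_cmult[of M UNIV "grad s" c]
    unfolding smooth_convex_def by simp
  ultimately show ?thesis
    unfolding smooth_convex_def grad by blast
qed

lemma convex_fun_add_scaled:
  fixes p q :: "'a::real_vector \<Rightarrow> ereal"
  assumes p: "convex_fun p" and q: "convex_fun q"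
    and p_fin: "\<And>x. p x \<noteq> -\<infinity>" and q_fin: "\<And>x. q x \<noteq> -\<infinity>" and c: "0 \<le> c"
  shows "convex_fun (\<lambda>x. p x + ereal c * q x)"
  unfolding convex_fun_def
proof (intro allI impI)
  fix x y :: 'a and u :: real assume u: "0 \<le> u \<and> u \<le> 1"
  let ?z = "(1 - u) *\<^sub>R x + u *\<^sub>R y"
  have "p ?z + ereal c * q ?z \<le>
      (ereal (1 - u) * p x + ereal u * p y) + ereal c * (ereal (1 - u) * q x + ereal u * q y)"
    using p q u c unfolding convex_fun_def by (intro add_mono ereal_mult_left_mono) auto
  also have "\<dots> = ereal (1 - u) * (p x + ereal c * q x) + ereal u * (p y + ereal c * q y)"
    using u c p_fin[of x] p_fin[of y] q_fin[of x] q_fin[of y]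
    by (cases "p x"; cases "p y"; cases "q x"; cases "q y")
       (auto simp: algebra_simps split: if_splits)
  finally show "p ?z + ereal c * q ?z \<le>
      ereal (1 - u) * (p x + ereal c * q x) + ereal u * (p y + ereal c * q y)" .
qed

section \<open>The accelerated proximal gradient step\<close>

lemma square_norm_add_scaled:
  fixes d e :: "'a::real_inner"
  shows "(norm (d + u *\<^sub>R e))\<^sup>2 = (norm d)\<^sup>2 + 2 * u * (d \<bullet> e) + u\<^sup>2 * (norm e)\<^sup>2"
  unfolding power2_norm_eq_inner
  by (simp add: inner_add_left inner_add_right inner_commute power2_eq_square algebra_simps)

text \<open>
  The fundamental inequality of a proximal gradient step.  The quadratic term makes the
  minimized model strongly convex, so its value at \<open>z\<close> exceeds the minimum by at least
  \<open>\<beta>/2 \<bar>w - z\<bar>\<^sup>2\<close>; the model overestimates \<open>h + p\<close> at \<open>w\<close> by the descent lemma, and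
  without its quadratic term it underestimates \<open>h + p\<close> at \<open>z\<close> by convexity.
\<close>

lemma prox_step:
  fixes h :: "'a::euclidean_space \<Rightarrow> real" and p :: "'a \<Rightarrow> ereal"
  assumes h: "smooth_convex L h" and L: "L \<le> \<beta>" and p: "convex_fun p"
    and min: "is_arg_min (\<lambda>v. p v + ereal (v \<bullet> grad h y + \<beta> / 2 * (norm (v - y))\<^sup>2)) (\<lambda>_. True) w"
    and pw: "p w = ereal P" and pz: "p z = ereal Q"
  shows "h w + P + \<beta> / 2 * (norm (w - z))\<^sup>2 \<le> h z + Q + \<beta> / 2 * (norm (y - z))\<^sup>2"
proof -
  define G where "G = grad h y"
  define I where "I = (w - y) \<bullet> (z - w)"
  define D where "D = (z - w) \<bullet> G"
  define A where "A = P - Q - D - \<beta> * I"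
  define B where "B = \<beta> / 2 * (norm (z - w))\<^sup>2"
  \<comment> \<open>\<open>A \<le> 0\<close> is the variational inequality at the minimizer \<open>w\<close>: compare \<open>w\<close> with nearby points of
    the segment towards \<open>z\<close>, divide by \<open>u\<close>, and let \<open>u\<close> tend to \<open>0\<close>.\<close>
  have A_le: "A \<le> u * B" if u: "0 < u" "u \<le> 1" for u
  proof -
    define v where "v = (1 - u) *\<^sub>R w + u *\<^sub>R z"
    have v: "v - y = (w - y) + u *\<^sub>R (z - w)" "v \<bullet> G = w \<bullet> G + u * D"
      by (simp_all add: v_def D_def algebra_simps inner_diff_left inner_add_left)
    have "ereal (P + (w \<bullet> G + \<beta> / 2 * (norm (w - y))\<^sup>2)) \<le> p v + ereal (v \<bullet> G + \<beta> / 2 * (norm (v - y))\<^sup>2)"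
      using min pw unfolding is_arg_min_linorder G_def by (metis plus_ereal.simps(1))
    also have "p v \<le> ereal ((1 - u) * P + u * Q)"
      using p u pw pz unfolding convex_fun_def v_def by (metis less_imp_le plus_ereal.simps(1) times_ereal.simps(1))
    finally have "P + (w \<bullet> G + \<beta> / 2 * (norm (w - y))\<^sup>2) \<le>
        (1 - u) * P + u * Q + (v \<bullet> G + \<beta> / 2 * (norm (v - y))\<^sup>2)"
      by (simp add: add_right_mono)
    moreover have "(norm (v - y))\<^sup>2 = (norm (w - y))\<^sup>2 + 2 * u * I + u\<^sup>2 * (norm (z - w))\<^sup>2"
      unfolding v(1) I_def by (rule square_norm_add_scaled)
    ultimately have "u * A \<le> u * (u * B)"
      unfolding A_def B_def v(2) by (simp add: algebra_simps power2_eq_square add_divide_distrib)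
    then show ?thesis
      using u by simp
  qed
  have "A \<le> 0"
  proof (rule tendsto_lowerbound)
    show "((\<lambda>u. u * B) \<longlongrightarrow> 0) (at_right 0)"
      by (auto intro!: tendsto_eq_intros)
    show "\<forall>\<^sub>F u in at_right 0. A \<le> u * B"
      using A_le by (auto simp: eventually_at_right_field intro!: exI[of _ 1])
  qed simp
  moreover have "h w \<le> h y + (w - y) \<bullet> G + \<beta> / 2 * (norm (w - y))\<^sup>2"
    using smooth_convex_descent[OF h, of w y] mult_right_mono[OF L, of "(norm (w - y))\<^sup>2 / 2"]
    unfolding G_def by simp
  moreover have "h y + (z - y) \<bullet> G \<le> h z"
    unfolding G_def by (rule smooth_convex_above_tangent[OF h])
  moreover have "(z - y) \<bullet> G = (w - y) \<bullet> G + D"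
    by (simp add: D_def inner_diff_left)
  moreover have "(norm (y - z))\<^sup>2 = (norm (w - y))\<^sup>2 + 2 * I + (norm (w - z))\<^sup>2"
    by (simp add: I_def power2_norm_eq_inner inner_diff_left inner_diff_right inner_commute algebra_simps)
  ultimately show ?thesis
    unfolding A_def by (simp add: algebra_simps)
qed

text \<open>
  Comparing \<open>w\<close> not with \<open>z\<close> but with the convex combination \<open>(1 - 1/t) x + (1/t) z\<close> of the
  previous iterate and \<open>z\<close> makes room for acceleration: after multiplication by \<open>t\<^sup>2\<close> both norms
  become norms of momentum vectors that can be matched across iterations.  For \<open>t = 1\<close> the point
  \<open>x\<close> drops out, so \<open>p x\<close> may then be infinite and \<open>R\<close> arbitrary.
\<close>

lemma accelerated_prox_step:
  fixes h :: "'a::euclidean_space \<Rightarrow> real" and p :: "'a \<Rightarrow> ereal"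
  assumes h: "smooth_convex L h" and L: "L \<le> \<beta>" and p: "convex_fun p" and p_fin: "\<And>v. p v \<noteq> -\<infinity>"
    and min: "is_arg_min (\<lambda>v. p v + ereal (v \<bullet> grad h y + \<beta> / 2 * (norm (v - y))\<^sup>2)) (\<lambda>_. True) w"
    and pw: "p w = ereal P" and pz: "p z = ereal Q"
    and t: "1 \<le> t" and px: "t = 1 \<or> p x = ereal R"
  shows "t\<^sup>2 * ((h w + P) - (h z + Q)) + \<beta> / 2 * (norm (t *\<^sub>R w - (t - 1) *\<^sub>R x - z))\<^sup>2
     \<le> t * (t - 1) * ((h x + R) - (h z + Q)) + \<beta> / 2 * (norm (t *\<^sub>R y - (t - 1) *\<^sub>R x - z))\<^sup>2"
proof -
  define v where "v = (1 - 1 / t) *\<^sub>R x + (1 / t) *\<^sub>R z"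
  have u: "0 \<le> 1 / t \<and> 1 / t \<le> 1"
    using t by simp
  have "p v \<le> ereal (1 - 1 / t) * p x + ereal (1 / t) * p z"
    using p u unfolding convex_fun_def v_def by blast
  also have "\<dots> = ereal ((1 - 1 / t) * R + 1 / t * Q)"
    using px pz by (auto simp: zero_ereal_def[symmetric])
  finally have pv_le: "p v \<le> ereal ((1 - 1 / t) * R + 1 / t * Q)" .
  then obtain S where S: "p v = ereal S" and S_le: "S \<le> (1 - 1 / t) * R + 1 / t * Q"
    using p_fin[of v] by (cases "p v") auto
  have hv: "h v \<le> (1 - 1 / t) * h x + 1 / t * h z"
    using h convex_onD[of UNIV h "1 / t" x z] u unfolding smooth_convex_def v_def by simp
  have scale: "t\<^sup>2 * (norm (b - v))\<^sup>2 = (norm (t *\<^sub>R b - (t - 1) *\<^sub>R x - z))\<^sup>2" for b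
  proof -
    have "t *\<^sub>R b - (t - 1) *\<^sub>R x - z = t *\<^sub>R (b - v)"
      using t by (simp add: v_def algebra_simps)
    then show ?thesis
      by (simp add: power_mult_distrib)
  qed
  have "h w + P + \<beta> / 2 * (norm (w - v))\<^sup>2 \<le>
      (1 - 1 / t) * (h x + R) + 1 / t * (h z + Q) + \<beta> / 2 * (norm (y - v))\<^sup>2"
    using prox_step[OF h L p min pw S] S_le hv by (simp add: algebra_simps)
  then have "t\<^sup>2 * (h w + P + \<beta> / 2 * (norm (w - v))\<^sup>2) \<le>
      t\<^sup>2 * ((1 - 1 / t) * (h x + R) + 1 / t * (h z + Q) + \<beta> / 2 * (norm (y - v))\<^sup>2)"
    by (rule mult_left_mono) simp
  also have "\<dots> = t * (t - 1) * (h x + R) + t * (h z + Q) + \<beta> / 2 * (t\<^sup>2 * (norm (y - v))\<^sup>2)"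
    using t by (simp add: field_simps power2_eq_square)
  finally show ?thesis
    unfolding scale[symmetric] by (simp add: algebra_simps power2_eq_square)
qed

section \<open>The parameter sequences\<close>

text \<open>
  The integral comparison for \<open>s\<^bsup>-p-1\<^esup>\<close> in the form of a tangent inequality for the convex function
  \<open>s\<^bsup>-p\<^esup>\<close>, obtained from \<open>exp v \<ge> 1 + v\<close> and \<open>ln (1 - 1/s) \<le> -1/s\<close>.
\<close>

lemma powr_le_difference:
  fixes s p :: real
  assumes "1 < s" "0 < p"
  shows "p * s powr (- p - 1) \<le> (s - 1) powr - p - s powr - p"
proof -
  have "ln (1 - 1 / s) \<le> - (1 / s)"
    using assms ln_add_one_self_le_self2[of "- (1 / s)"] by simp
  then have "p * (1 / s) \<le> - p * ln (1 - 1 / s)"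
    using assms mult_left_mono[of "ln (1 - 1 / s)" "- (1 / s)" p] by simp
  then have "1 + p / s \<le> 1 + (- p * ln (1 - 1 / s))"
    by simp
  also have "\<dots> \<le> exp (- p * ln (1 - 1 / s))"
    by (rule exp_ge_add_one_self)
  also have "\<dots> = (1 - 1 / s) powr - p"
    using assms by (simp add: powr_def)
  finally have "s powr - p * (1 + p / s) \<le> s powr - p * (1 - 1 / s) powr - p"
    by (rule mult_left_mono) simp
  also have "\<dots> = (s * (1 - 1 / s)) powr - p"
    using assms by (subst powr_mult) auto
  also have "s * (1 - 1 / s) = s - 1"
    using assms by (simp add: field_simps)
  finally show ?thesis
    using assms by (simp add: powr_diff field_simps)
qed

text \<open>
  Each summand is \<open>s\<^bsup>1-\<gamma>\<^esup> / a\<close> with \<open>s = j + a\<close>, and is dominated by a term of the telescoping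
  series of \<open>s\<^bsup>2-\<gamma>\<^esup> / (\<gamma> - 2)\<close>, which starts at \<open>(a - 1)\<^bsup>2-\<gamma>\<^esup> / (\<gamma> - 2)\<close>.
  The factor \<open>1 / a\<close> is given away.
\<close>

lemma sum_reg_step_le:
  assumes "2 \<le> a" "2 < \<gamma>"
  shows "(\<Sum>j<n. reg_param \<gamma> a (int j) * step_param a (int j)) \<le> 1 / (\<gamma> - 2)"
proof -
  let ?P = "\<lambda>i. (real_of_int a - 1 + real i) powr - (\<gamma> - 2)"
  have "reg_param \<gamma> a (int j) * step_param a (int j) \<le> (?P j - ?P (Suc j)) / (\<gamma> - 2)" for j
  proof -
    let ?s = "real_of_int (int j + a)"
    have s: "1 < ?s" using assms by linarith
    have "reg_param \<gamma> a (int j) * step_param a (int j) = ?s powr (- (\<gamma> - 2) - 1) / real_of_int a"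
    proof -
      have "?s powr (- (\<gamma> - 2) - 1) = ?s powr (- \<gamma> + 1)"
        by (rule arg_cong[where f = "\<lambda>e. ?s powr e"]) simp
      also have "\<dots> = ?s powr - \<gamma> * ?s"
        using s by (subst powr_add) simp
      finally show ?thesis
        by (simp add: reg_param_def step_param_def)
    qed
    also have "\<dots> \<le> ?s powr (- (\<gamma> - 2) - 1)"
      using assms by (simp add: divide_le_eq mult_le_cancel_left1)
    also have "\<dots> \<le> (?P j - ?P (Suc j)) / (\<gamma> - 2)"
      using powr_le_difference[OF s, of "\<gamma> - 2"] assms
      by (simp add: pos_le_divide_eq mult.commute algebra_simps)
    finally show ?thesis .
  qed
  then have "(\<Sum>j<n. reg_param \<gamma> a (int j) * step_param a (int j)) \<le> (\<Sum>j<n. (?P j - ?P (Suc j)) / (\<gamma> - 2))"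
    by (rule sum_mono)
  also have "\<dots> = (?P 0 - ?P n) / (\<gamma> - 2)"
    using sum_lessThan_telescope'[of ?P n] by (simp only: sum_divide_distrib[symmetric])
  also have "\<dots> \<le> 1 / (\<gamma> - 2)"
  proof (rule divide_right_mono)
    have "?P 0 \<le> 1 powr - (\<gamma> - 2)"
      using assms by (intro powr_mono2') auto
    moreover have "0 \<le> ?P n"
      by simp
    ultimately show "?P 0 - ?P n \<le> 1"
      unfolding powr_one_eq_one by linarith
  qed (use assms in simp)
  finally show ?thesis .
qed

lemma reg_param_pos: "0 \<le> k \<Longrightarrow> 2 \<le> a \<Longrightarrow> 0 < reg_param \<gamma> a k"
  by (simp add: reg_param_def)

lemma reg_param_antimono:
  assumes "0 \<le> j" "j \<le> k" "2 \<le> a" "0 < \<gamma>"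
  shows "reg_param \<gamma> a k \<le> reg_param \<gamma> a j"
  using assms by (auto simp: reg_param_def intro!: powr_mono2')

lemma reg_param_le_1:
  assumes "2 \<le> a" "0 < \<gamma>"
  shows "reg_param \<gamma> a k \<le> 1"
  using powr_mono2'[of "-\<gamma>" 1 "real_of_int (k + a)"] assms by (auto simp: reg_param_def)

lemma step_param_ge_1: "0 \<le> k \<Longrightarrow> 2 \<le> a \<Longrightarrow> 1 \<le> step_param a k"
  by (simp add: step_param_def)

text \<open>
  Up to the factor \<open>a\<^sup>2\<close>, the right side minus the left side is \<open>k (a - 2) + (a - 1)\<^sup>2\<close>; this is
  where \<open>a \<ge> 2\<close> enters the telescoping of the energy.
\<close>

lemma step_param_growth:
  assumes "1 \<le> k" "2 \<le> a"
  shows "step_param a k * (step_param a k - 1) \<le> (step_param a (k - 1))\<^sup>2"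
proof -
  have "k * (a - 2) + (a - 1)\<^sup>2 \<ge> 0"
    using assms by simp
  then have "(k + a) * k \<le> (k - 1 + a)\<^sup>2"
    by (simp add: power2_eq_square algebra_simps)
  then have "real_of_int ((k + a) * k) \<le> real_of_int ((k - 1 + a)\<^sup>2)"
    by (simp only: of_int_le_iff)
  then have "real_of_int (k + a) * real_of_int k / (real_of_int a)\<^sup>2 \<le> (real_of_int (k - 1 + a))\<^sup>2 / (real_of_int a)\<^sup>2"
    by (intro divide_right_mono) simp_all
  moreover have "step_param a k * (step_param a k - 1) = real_of_int (k + a) * real_of_int k / (real_of_int a)\<^sup>2"
    using assms by (simp add: step_param_def field_simps power2_eq_square)
  ultimately show ?thesis
    using assms by (simp add: step_param_def power_divide)
qed

section \<open>The energy of a run of the algorithm\<close>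

text \<open>
  The reference point \<open>x'\<close> is any inner solution at which the outer objective is finite;
  outer solutions are a special case.
\<close>

locale fbi_pg_run =
  fixes f \<sigma> :: "'a::euclidean_space \<Rightarrow> real"
    and g \<psi> :: "'a \<Rightarrow> ereal"
    and \<beta>\<^sub>f \<beta>\<^sub>\<sigma> \<beta> \<gamma> :: real
    and a :: int
    and x :: "int \<Rightarrow> 'a"
    and x' :: 'a
  assumes \<beta>_eq: "\<beta> = \<beta>\<^sub>f + \<beta>\<^sub>\<sigma>"
    and smooth_f: "smooth_convex \<beta>\<^sub>f f" and smooth_\<sigma>: "smooth_convex \<beta>\<^sub>\<sigma> \<sigma>"
    and proper_g: "proper_fun g" and convex_g: "convex_fun g"
    and proper_\<psi>: "proper_fun \<psi>" and convex_\<psi>: "convex_fun \<psi>"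
    and \<omega>_bounded_below: "(INF z. objective \<sigma> \<psi> z) > -\<infinity>"
    and \<gamma>: "\<gamma> > 2" and a: "a \<ge> 2"
    and run: "fbi_pg f g \<sigma> \<psi> \<beta> \<gamma> a x"
    and x'_inner: "x' \<in> inner_solutions (objective f g)"
    and x'_finite: "\<bar>objective \<sigma> \<psi> x'\<bar> \<noteq> \<infinity>"
begin

abbreviation \<alpha> :: "int \<Rightarrow> real" where "\<alpha> \<equiv> reg_param \<gamma> a"
abbreviation t :: "int \<Rightarrow> real" where "t \<equiv> step_param a"

text \<open>
  Real-valued versions of the objectives and of the outer infimum.  They agree with the
  extended-real ones wherever \<open>g\<close> respectively \<open>\<psi>\<close> is finite, in particular at \<open>x'\<close> and at all
  iterates from index \<open>1\<close> on.
\<close>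

definition inner_value :: "'a \<Rightarrow> real" where "inner_value v = f v + real_of_ereal (g v)"
definition outer_value :: "'a \<Rightarrow> real" where "outer_value v = \<sigma> v + real_of_ereal (\<psi> v)"
definition outer_inf :: real where "outer_inf = real_of_ereal (INF z. objective \<sigma> \<psi> z)"

definition momentum :: "int \<Rightarrow> 'a" where
  "momentum k = t (k - 1) *\<^sub>R x k - (t (k - 1) - 1) *\<^sub>R x (k - 1) - x'"

text \<open>
  The index of \<open>\<alpha>\<close> and \<open>t\<close> is \<open>k - 1\<close> because \<open>x k\<close> is produced in step \<open>k - 1\<close>.  At \<open>k = 0\<close> the weight
  \<open>t (-1) = 0\<close> removes the objective values, which may be meaningless at the starting point.
\<close>

definition energy :: "int \<Rightarrow> real" where
  "energy k = (t (k - 1))\<^sup>2 *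
      ((inner_value (x k) - inner_value x') + \<alpha> (k - 1) * (outer_value (x k) - outer_inf))
    + \<beta> / 2 * (norm (momentum k))\<^sup>2"

lemma g_not_MInf: "g v \<noteq> -\<infinity>" and \<psi>_not_MInf: "\<psi> v \<noteq> -\<infinity>"
  using proper_g proper_\<psi> unfolding proper_fun_def by auto

lemma \<psi>_x'_finite: "\<bar>\<psi> x'\<bar> \<noteq> \<infinity>"
  using x'_finite unfolding objective_def by auto

lemma g_x'_finite: "\<bar>g x'\<bar> \<noteq> \<infinity>"
proof -
  obtain v where v: "g v \<noteq> \<infinity>"
    using proper_g unfolding proper_fun_def by blast
  have "objective f g x' \<le> objective f g v"
    using x'_inner by (simp add: inner_solutions_def is_arg_min_linorder)
  then show ?thesis
    using v g_not_MInf[of x'] unfolding objective_def by (cases "g x'") auto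
qed

lemma inner_value_eq: "\<bar>g v\<bar> \<noteq> \<infinity> \<Longrightarrow> objective f g v = ereal (inner_value v)"
  unfolding objective_def inner_value_def by (cases "g v") auto

lemma outer_value_eq: "\<bar>\<psi> v\<bar> \<noteq> \<infinity> \<Longrightarrow> objective \<sigma> \<psi> v = ereal (outer_value v)"
  unfolding objective_def outer_value_def by (cases "\<psi> v") auto

lemma reg_nonsmooth_eq:
  "\<bar>g v\<bar> \<noteq> \<infinity> \<Longrightarrow> \<bar>\<psi> v\<bar> \<noteq> \<infinity> \<Longrightarrow>
    reg_nonsmooth g \<psi> \<gamma> a k v = ereal (real_of_ereal (g v) + \<alpha> k * real_of_ereal (\<psi> v))"
  unfolding reg_nonsmooth_def by (cases "g v"; cases "\<psi> v") auto

lemma reg_nonsmooth_not_MInf: "0 \<le> k \<Longrightarrow> reg_nonsmooth g \<psi> \<gamma> a k v \<noteq> -\<infinity>"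
  using g_not_MInf[of v] \<psi>_not_MInf[of v] reg_param_pos[OF _ a, of k \<gamma>]
  unfolding reg_nonsmooth_def by (cases "g v"; cases "\<psi> v") auto

lemma outer_inf_eq: "(INF z. objective \<sigma> \<psi> z) = ereal outer_inf"
proof -
  have "(INF z. objective \<sigma> \<psi> z) \<le> ereal (outer_value x')"
    using INF_lower[of x' UNIV "objective \<sigma> \<psi>"] outer_value_eq[OF \<psi>_x'_finite] by simp
  then show ?thesis
    using \<omega>_bounded_below unfolding outer_inf_def
    by (cases "INF z. objective \<sigma> \<psi> z") auto
qed

lemma outer_inf_le:
  assumes "\<bar>\<psi> v\<bar> \<noteq> \<infinity>"
  shows "outer_inf \<le> outer_value v"
  using INF_lower[of v UNIV "objective \<sigma> \<psi>"] unfolding outer_value_eq[OF assms] outer_inf_eq by simp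

lemma inner_value_x'_le:
  assumes "\<bar>g v\<bar> \<noteq> \<infinity>"
  shows "inner_value x' \<le> inner_value v"
proof -
  have "objective f g x' \<le> objective f g v"
    using x'_inner by (simp add: inner_solutions_def is_arg_min_linorder)
  then show ?thesis
    unfolding inner_value_eq[OF assms] inner_value_eq[OF g_x'_finite] by simp
qed

lemma iterate_is_arg_min:
  assumes "0 \<le> k"
  shows "is_arg_min
      (\<lambda>v. reg_nonsmooth g \<psi> \<gamma> a k v
          + ereal (v \<bullet> grad (reg_smooth f \<sigma> \<gamma> a k) (extrapolation a x k)
                   + \<beta> / 2 * (norm (v - extrapolation a x k))\<^sup>2))
      (\<lambda>_. True) (x (k + 1))"
  using run assms unfolding fbi_pg_def by blast

text \<open>
  The subproblem solved by \<open>x k\<close> has a finite value at \<open>x'\<close>, hence at its minimizer;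
  since \<open>\<alpha> (k - 1) > 0\<close>, this forces both \<open>g\<close> and \<open>\<psi>\<close> to be finite there.
\<close>

lemma iterate_finite:
  assumes "1 \<le> k"
  shows "\<bar>g (x k)\<bar> \<noteq> \<infinity>" and "\<bar>\<psi> (x k)\<bar> \<noteq> \<infinity>"
proof -
  have k: "0 \<le> k - 1" using assms by simp
  obtain p c d where "reg_nonsmooth g \<psi> \<gamma> a (k - 1) (x k) + ereal c
      \<le> reg_nonsmooth g \<psi> \<gamma> a (k - 1) x' + ereal d" and "reg_nonsmooth g \<psi> \<gamma> a (k - 1) x' = ereal p"
    using iterate_is_arg_min[OF k] reg_nonsmooth_eq[OF g_x'_finite \<psi>_x'_finite]
    unfolding is_arg_min_linorder by (metis diff_add_cancel)
  then have "reg_nonsmooth g \<psi> \<gamma> a (k - 1) (x k) \<noteq> \<infinity>"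
    by auto
  then show "\<bar>g (x k)\<bar> \<noteq> \<infinity>" and "\<bar>\<psi> (x k)\<bar> \<noteq> \<infinity>"
    using g_not_MInf[of "x k"] \<psi>_not_MInf[of "x k"] reg_param_pos[OF k a, of \<gamma>]
    unfolding reg_nonsmooth_def by (cases "g (x k)"; cases "\<psi> (x k)"; simp)+
qed

text \<open>
  The extrapolation rule is designed so that the vector appearing on the right of
  \<open>accelerated_prox_step\<close> in step \<open>k\<close> is the one that appeared on its left in step \<open>k - 1\<close>.
\<close>

lemma momentum_extrapolation:
  assumes "0 \<le> k"
  shows "t k *\<^sub>R extrapolation a x k - (t k - 1) *\<^sub>R x k - x' = momentum k"
proof -
  have "t k * (inverse (t k) * (t (k - 1) - 1)) = t (k - 1) - 1"
    using step_param_ge_1[OF assms a] by simp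
  then have "t k *\<^sub>R extrapolation a x k = t k *\<^sub>R x k + (t (k - 1) - 1) *\<^sub>R (x k - x (k - 1))"
    unfolding extrapolation_def scaleR_add_right scaleR_scaleR by simp
  then show ?thesis
    unfolding momentum_def by (simp add: algebra_simps)
qed

text \<open>
  The accelerated step compares outer values with \<open>outer_value x'\<close>, the energy compares them with
  the infimum; the error term is the cost of this shift.  The shift makes every
  difference nonnegative, so that both the decrease of \<open>\<alpha>\<close> and the growth condition on \<open>t\<close> work
  in the right direction.
\<close>

lemma energy_step:
  assumes k: "0 \<le> k"
  shows "energy (k + 1) \<le> energy k + \<alpha> k * t k * (outer_value x' - outer_inf)"
proof -
  let ?gap = "\<lambda>v. inner_value v - inner_value x'"
  let ?exc = "\<lambda>v. outer_value v - outer_inf"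
  let ?p = "reg_nonsmooth g \<psi> \<gamma> a k"
  let ?F = "\<lambda>v. inner_value v + \<alpha> k * outer_value v"
  let ?P = "\<lambda>v. real_of_ereal (g v) + \<alpha> k * real_of_ereal (\<psi> v)"
  have \<alpha>: "0 < \<alpha> k" and t: "1 \<le> t k"
    using k a by (simp_all add: reg_param_pos step_param_ge_1)
  have fin: "\<bar>g (x (k + 1))\<bar> \<noteq> \<infinity>" "\<bar>\<psi> (x (k + 1))\<bar> \<noteq> \<infinity>"
    using iterate_finite[of "k + 1"] k by simp_all
  have smooth: "smooth_convex (\<beta>\<^sub>f + \<alpha> k * \<beta>\<^sub>\<sigma>) (reg_smooth f \<sigma> \<gamma> a k)"
    unfolding reg_smooth_def[abs_def] using smooth_f smooth_\<sigma> \<alpha> by (intro smooth_convex_add_scaled) auto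
  have "0 \<le> \<beta>\<^sub>\<sigma>"
    using smooth_\<sigma> lipschitz_on_nonneg unfolding smooth_convex_def by blast
  then have L: "\<beta>\<^sub>f + \<alpha> k * \<beta>\<^sub>\<sigma> \<le> \<beta>"
    using reg_param_le_1[OF a, of \<gamma> k] \<gamma> by (simp add: \<beta>_eq mult_left_le_one_le \<alpha> less_imp_le)
  have conv: "convex_fun ?p"
    unfolding reg_nonsmooth_def[abs_def]
    using convex_g convex_\<psi> g_not_MInf \<psi>_not_MInf \<alpha> by (intro convex_fun_add_scaled) auto
  have px: "t k = 1 \<or> ?p (x k) = ereal (?P (x k))"
  proof (cases "k = 0")
    case True then show ?thesis using a by (simp add: step_param_def)
  next
    case False then show ?thesis using k iterate_finite[of k] reg_nonsmooth_eq by simp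
  qed
  have F: "reg_smooth f \<sigma> \<gamma> a k v + ?P v = ?F v" for v
    by (simp add: reg_smooth_def inner_value_def outer_value_def algebra_simps)
  have mom: "t k *\<^sub>R x (k + 1) - (t k - 1) *\<^sub>R x k - x' = momentum (k + 1)"
    by (simp add: momentum_def)
  have "(t k)\<^sup>2 * (?F (x (k + 1)) - ?F x') + \<beta> / 2 * (norm (momentum (k + 1)))\<^sup>2
      \<le> t k * (t k - 1) * (?F (x k) - ?F x') + \<beta> / 2 * (norm (momentum k))\<^sup>2"
    using accelerated_prox_step[OF smooth L conv reg_nonsmooth_not_MInf[OF k] iterate_is_arg_min[OF k]
        reg_nonsmooth_eq[OF fin] reg_nonsmooth_eq[OF g_x'_finite \<psi>_x'_finite] t px]
    unfolding F mom momentum_extrapolation[OF k] .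
  then have "energy (k + 1) \<le> t k * (t k - 1) * (?gap (x k) + \<alpha> k * ?exc (x k))
      + \<beta> / 2 * (norm (momentum k))\<^sup>2 + \<alpha> k * t k * ?exc x'"
    unfolding energy_def by (simp add: algebra_simps power2_eq_square)
  also have "t k * (t k - 1) * (?gap (x k) + \<alpha> k * ?exc (x k))
      \<le> (t (k - 1))\<^sup>2 * (?gap (x k) + \<alpha> (k - 1) * ?exc (x k))"
  proof (cases "k = 0")
    \<comment> \<open>Here the differences at \<open>x 0\<close> may have any sign, but both weights vanish.\<close>
    case True then show ?thesis using a by (simp add: step_param_def)
  next
    case False
    then have k1: "1 \<le> k" using k by simp
    then have "0 \<le> ?gap (x k)" "0 \<le> ?exc (x k)"
      using inner_value_x'_le outer_inf_le iterate_finite by simp_all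
    then show ?thesis
      using step_param_growth[OF k1 a] reg_param_antimono[of "k - 1" k a \<gamma>] k1 a \<gamma> \<alpha>
      by (intro mult_mono add_mono) auto
  qed
  finally show ?thesis
    unfolding energy_def by simp
qed

lemma energy_le_sum:
  "energy (int n) \<le> energy 0 + (\<Sum>j<n. \<alpha> (int j) * t (int j)) * (outer_value x' - outer_inf)"
proof (induction n)
  case (Suc n)
  have "energy (int (Suc n)) \<le> energy (int n) + \<alpha> (int n) * t (int n) * (outer_value x' - outer_inf)"
    using energy_step[of "int n"] by (simp add: add.commute)
  then show ?case
    using Suc by (simp add: distrib_right)
qed simp

lemma energy_0: "energy 0 = \<beta> / 2 * (norm (x 0 - x'))\<^sup>2"
  using run by (simp add: energy_def momentum_def step_param_def fbi_pg_def)

lemma inner_gap_le: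
  assumes \<beta>: "0 < \<beta>" and k: "1 \<le> k"
  shows "inner_value (x k) - inner_value x' \<le>
    (real_of_int a)\<^sup>2 / (2 * (real_of_int k + 1)\<^sup>2) *
      (\<beta> * (norm (x 0 - x'))\<^sup>2 + 2 / (\<gamma> - 2) * (outer_value x' - outer_inf))"
proof -
  let ?gap = "inner_value (x k) - inner_value x'"
  let ?W = "outer_value x' - outer_inf"
  let ?c = "(real_of_int k + 1) / real_of_int a"
  have gap: "0 \<le> ?gap"
    using inner_value_x'_le iterate_finite k by simp
  have exc: "0 \<le> outer_value (x k) - outer_inf"
    using outer_inf_le iterate_finite k by simp
  have W: "0 \<le> ?W"
    using outer_inf_le \<psi>_x'_finite by simp
  have "?c \<le> t (k - 1)"
    using a k by (simp add: step_param_def divide_right_mono)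
  then have "?c\<^sup>2 * ?gap \<le> (t (k - 1))\<^sup>2 * ?gap"
    using a k gap by (intro mult_right_mono power_mono) auto
  also have "\<dots> \<le> energy k"
  proof -
    have "0 \<le> (t (k - 1))\<^sup>2 * (\<alpha> (k - 1) * (outer_value (x k) - outer_inf))"
      using exc k a reg_param_pos[of "k - 1" a \<gamma>] by simp
    moreover have "0 \<le> \<beta> / 2 * (norm (momentum k))\<^sup>2"
      using \<beta> by simp
    ultimately show ?thesis
      unfolding energy_def distrib_left by linarith
  qed
  also have "\<dots> \<le> energy 0 + 1 / (\<gamma> - 2) * ?W"
    using energy_le_sum[of "nat k"] mult_right_mono[OF sum_reg_step_le[OF a \<gamma>, of "nat k"] W] k by simp
  also have "\<dots> = (\<beta> * (norm (x 0 - x'))\<^sup>2 + 2 / (\<gamma> - 2) * ?W) / 2"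
    unfolding energy_0 using \<gamma> by (simp add: field_simps)
  finally show ?thesis
    using a k by (simp add: power_divide pos_le_divide_eq field_simps)
qed

end

section \<open>The convergence rate of the inner objective\<close>

theorem theorem1:
  fixes f \<sigma> :: "real ^ 'n \<Rightarrow> real"
    and g \<psi> :: "real ^ 'n \<Rightarrow> ereal"
    and \<phi> \<omega> :: "real ^ 'n \<Rightarrow> ereal"
    and \<beta>\<^sub>f \<beta>\<^sub>\<sigma> \<beta> \<gamma> :: real
    and \<omega>_star :: ereal
    and a k :: int
    and x :: "int \<Rightarrow> real ^ 'n"
    and x' :: "real ^ 'n"
  defines "\<phi> \<equiv> objective f g"
    and "\<omega> \<equiv> objective \<sigma> \<psi>"
    and "\<omega>_star \<equiv> (INF z. \<omega> z)"
    and "\<beta> \<equiv> \<beta>\<^sub>f + \<beta>\<^sub>\<sigma>"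
  assumes "smooth_convex \<beta>\<^sub>f f" and "smooth_convex \<beta>\<^sub>\<sigma> \<sigma>" and "\<beta> > 0"
    and "proper_fun g" and "lower_semicontinuous g" and "convex_fun g"
    and "proper_fun \<psi>" and "lower_semicontinuous \<psi>" and "convex_fun \<psi>"
    and "inner_solutions \<phi> \<noteq> {}"
    and "\<omega>_star > -\<infinity>"
    and "\<gamma> > 2" and "a \<ge> 2"
    and "fbi_pg f g \<sigma> \<psi> \<beta> \<gamma> a x"
    and "k \<ge> 1"
    and "x' \<in> outer_solutions \<phi> \<omega>"
  shows "\<phi> (x k) - \<phi> x' \<le>
    ereal ((real_of_int a)\<^sup>2 / (2 * (real_of_int k + 1)\<^sup>2)) *
      (ereal (\<beta> * (norm (x 0 - x'))\<^sup>2) + ereal (2 / (\<gamma> - 2)) * (\<omega> x' - \<omega>_star))"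
proof -
  interpret fbi_pg_run f \<sigma> g \<psi> \<beta>\<^sub>f \<beta>\<^sub>\<sigma> \<beta> \<gamma> a x x'
    using assms unfolding outer_solutions_def is_arg_min_def by unfold_locales auto
  have "\<phi> (x k) = ereal (inner_value (x k))" "\<phi> x' = ereal (inner_value x')"
    and "\<omega> x' = ereal (outer_value x')" "\<omega>_star = ereal outer_inf"
    unfolding \<phi>_def \<omega>_def \<omega>_star_def
    using inner_value_eq outer_value_eq outer_inf_eq iterate_finite(1)[OF \<open>k \<ge> 1\<close>]
      g_x'_finite \<psi>_x'_finite by simp_all
  then show ?thesis
    using inner_gap_le[OF \<open>\<beta> > 0\<close> \<open>k \<ge> 1\<close>] by simp
qed

end
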